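(* Let $c_1$ and $c_2$ be two points outside the closed unit disk in the complex plane. Then there exists a unique normalized Blaschke product $B\in\mathcal{B}$ whose critical points are located at $0,\ \infty,\ c_1,\ c_2,\ 1/\overline{c_1},\ 1/\overline{c_2}$.
   Context: Let $\hat{\mathcal{B}}$ be the set of degree $5$ normalized Blaschke products $$B:z\mapsto\tau z^3\left(\frac{z-p}{1-\overline{p}z}\right)\left(\frac{z-q}{1-\overline{q}z}\right),\qquad |p|>1,\ |q|>1,\ B(1)=1,$$ where $|\tau|=1$ is the rotation factor chosen so that $B(1)=1$. Each $B\in\hat{\mathcal{B}}$ has superattracting fixed points at $0$ and $\infty$ (critical points of multiplicity two) and four other critical points counted with multiplicity. $\mathcal{B}\subset\hat{\mathcal{B}}$ is the open subset of those $B$ whose four critical points other than $0$ and $\infty$, counted with multiplicity, are of the form $c_1,c_2,1/\overline{c_1},1/\overline{c_2}$ with $|c_1|>1$ and $|c_2|>1$. *)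

theory Defs
  imports "HOL-Complex_Analysis.Complex_Analysis" "HOL-Library.Multiset"
begin

text \<open>
  Rational maps are represented by functions on the complex plane. Division by zero gives the
  value 0 at the poles, which is the convention of \<^const>\<open>nicely_meromorphic_on\<close>, so two maps
  of the form below agree as functions iff they agree as self-maps of the Riemann sphere.
\<close>

definition blaschke :: "complex \<Rightarrow> complex \<Rightarrow> complex \<Rightarrow> complex \<Rightarrow> complex" where
  "blaschke \<tau> p q z = \<tau> * z ^ 3 * ((z - p) / (1 - cnj p * z)) * ((z - q) / (1 - cnj q * z))"

definition B_hat :: "(complex \<Rightarrow> complex) set" where
  "B_hat = {blaschke \<tau> p q | \<tau> p q.
     norm \<tau> = 1 \<and> norm p > 1 \<and> norm q > 1 \<and> blaschke \<tau> p q 1 = 1}"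

text \<open>
  The local degree of a nonconstant meromorphic function, as a map to the Riemann sphere.
  At a point that is not a pole, the limit is the value of the function with any removable
  singularity removed; this matters for the coordinate at infinity below.
\<close>

definition local_degree :: "(complex \<Rightarrow> complex) \<Rightarrow> complex \<Rightarrow> nat" where
  "local_degree f z =
     (if is_pole f z then nat (- zorder f z)
      else nat (zorder (\<lambda>w. f w - Lim (at z) f) z))"

text \<open>
  Points of the Riemann sphere are elements of \<^typ>\<open>complex option\<close>, with \<^const>\<open>None\<close> as the
  point at infinity (as in \<^const>\<open>Alexandroff_compactification\<close>). The multiplicity of a point
  as a critical point is its local degree minus one; it is 0 iff the point is not critical.
\<close>

definition crit_mult :: "(complex \<Rightarrow> complex) \<Rightarrow> complex option \<Rightarrow> nat" where
  "crit_mult f x = (case x of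
       Some z \<Rightarrow> local_degree f z - 1
     | None \<Rightarrow> local_degree (\<lambda>w. f (inverse w)) 0 - 1)"

definition B_cal :: "(complex \<Rightarrow> complex) set" where
  "B_cal = {B \<in> B_hat. \<exists>a b. norm a > 1 \<and> norm b > 1 \<and>
     (\<forall>x. x \<notin> {Some 0, None} \<longrightarrow>
        crit_mult B x = count {#Some a, Some b, Some (1 / cnj a), Some (1 / cnj b)#} x)}"

end

theory Submission
  imports Defs "HOL-Computational_Algebra.Fundamental_Theorem_Algebra" "HOL-Real_Asymp.Real_Asymp"
begin

text \<open>
  Put \<open>s = p + q\<close> and \<open>m = p * q\<close>. Then \<open>B = \<tau> z\<^sup>3 P / Q\<close> with \<open>P = z\<^sup>2 - s z + m\<close> and
  \<open>Q = 1 - cnj s z + cnj m z\<^sup>2\<close>, and \<open>B' = \<tau> z\<^sup>2 N / Q\<^sup>2\<close> for a polynomial \<open>N\<close> of degree four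
  (\<open>crit_poly\<close>). The roots of \<open>N\<close>, with their orders, are the critical points of \<open>B\<close> other than
  \<open>0\<close> and \<open>\<infinity>\<close>; double poles included, because the order of the Wronskian of numerator and
  denominator computes the local degree at zeros, poles and other points alike
  (\<open>local_degree_poly_quotient\<close>). The problem is therefore to solve \<open>N = l * T\<close> for \<open>s\<close>, \<open>m\<close> and
  a constant \<open>l\<close>, where \<open>T = (z - c1) (z - c2) (1 - cnj c1 z) (1 - cnj c2 z)\<close> (\<open>mirror_poly\<close>),
  subject to the roots \<open>p\<close>, \<open>q\<close> of \<open>P\<close> lying outside the closed unit disk. The normalization
  \<open>B 1 = 1\<close> then determines \<open>\<tau>\<close>.

  Both polynomials are self-reciprocal, so \<open>N = l * T\<close> amounts to three equations, with \<open>l > 0\<close>. The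
  extreme coefficients give \<open>m\<close> in terms of \<open>r = norm m\<close>, the next ones are linear in \<open>s\<close> and
  \<open>cnj s\<close> and give \<open>s\<close> in terms of \<open>r\<close>. The middle coefficient leaves one real equation
  \<open>G r = 0\<close>. By the Schur-Cohn identity, the side condition on \<open>p\<close> and \<open>q\<close> becomes a second
  explicit inequality \<open>D r > 0\<close>.

  The sign of \<open>G\<close> is controlled by the unit circle. With \<open>s\<close>, \<open>m\<close> the functions of \<open>r\<close> just
  described, \<open>N / z\<^sup>2 = (positive) + r * G r\<close> for \<open>norm z = 1\<close> (\<open>crit_poly_split\<close>), while \<open>N / z\<^sup>2\<close> is
  explicit in terms of \<open>p\<close> and \<open>q\<close> (\<open>crit_poly_unit_circle\<close>): it vanishes at \<open>p\<close> if \<open>p\<close> lies on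
  the circle, and it is negative at \<open>p / norm p\<close> if \<open>1 < norm p \<le> 2\<close> and \<open>1 < norm q\<close>. Hence
  \<open>G r < 0\<close> if \<open>D r = 0\<close> and \<open>r \<ge> 4\<close>; also every solution has \<open>norm p > 2\<close> and
  \<open>norm q > 2\<close>, so that \<open>r > 4\<close>; and \<open>G 4 < 0\<close> if \<open>D 4 > 0\<close>. On \<open>[4, \<infinity>)\<close> the function \<open>G\<close> is convex, and a convex function which
  is negative at the zeros of \<open>D\<close>, negative at the left end if \<open>D\<close> is positive there, and positive
  near infinity along with \<open>D\<close>, has exactly one zero with \<open>D > 0\<close> (\<open>ex1_zero_convex_constrained\<close>).
\<close>

section \<open>Local degrees of quotients of polynomials\<close>

text \<open>
  Only the first term of the Wronskian matters: \<open>R\<close> and hence \<open>R * pderiv C\<close> vanishes to a higher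
  order at \<open>z\<close> than \<open>pderiv R * C\<close>.
\<close>

lemma order_wronskian:
  fixes R C :: "'a :: field_char_0 poly"
  assumes "R \<noteq> 0" "poly R z = 0" "poly C z \<noteq> 0"
  shows "Suc (order z (pderiv R * C - R * pderiv C)) = order z R"
proof -
  define W where "W = pderiv R * C - R * pderiv C"
  define k where "k = order z (pderiv R)"
  have R: "order z R = Suc k" using order_pderiv[OF assms(1,2)] by (simp add: k_def)
  have "pderiv R \<noteq> 0"
  proof
    assume "pderiv R = 0"
    then obtain h where "R = [:h:]" using pderiv_iszero by blast
    with assms show False by simp
  qed
  moreover have "C \<noteq> 0" using assms by auto
  ultimately have X: "order z (pderiv R * C) = k" "pderiv R * C \<noteq> 0"
    using assms(3) by (simp_all add: order_mult k_def order_0I)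
  have Y: "[:- z, 1:] ^ Suc k dvd R * pderiv C"
    using order_1[of z R] unfolding R by (rule dvd_mult2)
  have "[:- z, 1:] ^ k dvd R * pderiv C"
    using Y by (rule dvd_trans[rotated]) (rule le_imp_power_dvd, simp)
  moreover have "[:- z, 1:] ^ k dvd pderiv R * C" using order_1[of z "pderiv R * C"] X by simp
  ultimately have "[:- z, 1:] ^ k dvd W" unfolding W_def by (rule dvd_diff[rotated])
  moreover have "\<not> [:- z, 1:] ^ Suc k dvd W"
  proof
    assume "[:- z, 1:] ^ Suc k dvd W"
    then have "[:- z, 1:] ^ Suc k dvd W + R * pderiv C" using Y by (rule dvd_add)
    then have "[:- z, 1:] ^ Suc k dvd pderiv R * C" by (simp add: W_def)
    with order_2[OF X(2), of z] X(1) show False by simp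
  qed
  ultimately show ?thesis using order_unique_lemma[of z k W] R by (simp add: W_def)
qed

lemma zorder_poly_quotient:
  fixes A C :: "complex poly"
  assumes "A \<noteq> 0" "C \<noteq> 0" and f: "eventually (\<lambda>w. f w = poly A w / poly C w) (at z)"
  shows "zorder f z = int (order z A) - int (order z C)"
proof -
  obtain A' where A': "A = [:- z, 1:] ^ order z A * A'" "\<not> [:- z, 1:] dvd A'"
    using order_decomp[OF assms(1)] by blast
  obtain C' where C': "C = [:- z, 1:] ^ order z C * C'" "\<not> [:- z, 1:] dvd C'"
    using order_decomp[OF assms(2)] by blast
  have nz: "poly A' z \<noteq> 0" "poly C' z \<noteq> 0" using A'(2) C'(2) by (simp_all add: poly_eq_0_iff_dvd)
  have op: "open {w. poly C' w \<noteq> 0}"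
    by (intro open_Collect_neq continuous_intros)
  have "zorder (\<lambda>w. poly A w / poly C w) z = int (order z A) - int (order z C)"
  proof (rule zorder_eqI[OF op])
    show "(\<lambda>w. poly A' w / poly C' w) holomorphic_on {w. poly C' w \<noteq> 0}"
      by (intro holomorphic_intros) auto
    fix w assume "w \<in> {w. poly C' w \<noteq> 0}" "w \<noteq> z"
    then show "poly A w / poly C w
        = poly A' w / poly C' w * (w - z) powi (int (order z A) - int (order z C))"
      by (subst A'(1), subst C'(1)) (simp add: power_int_diff mult.commute)
  qed (use nz in auto)
  with zorder_cong[OF f refl] show ?thesis by simp
qed

lemma eventually_poly_nz_at:
  fixes C :: "complex poly"
  assumes "C \<noteq> 0"
  shows "eventually (\<lambda>w. poly C w \<noteq> 0) (at z)"
  using islimpt_finite[OF poly_roots_finite[OF assms], of z]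
  by (simp add: islimpt_iff_eventually)

lemma local_degree_pole:
  fixes A C :: "complex poly"
  assumes f: "eventually (\<lambda>w. f w = poly A w / poly C w) (at z)"
    and A: "poly A z \<noteq> 0" and C: "poly C z = 0" "C \<noteq> 0"
  shows "local_degree f z = order z C"
proof -
  have "A \<noteq> 0" using A by auto
  have "filterlim (\<lambda>w. poly A w / poly C w) at_infinity (at z)"
  proof (rule filterlim_divide_at_infinity)
    show "poly A \<midarrow>z\<rightarrow> poly A z" by (intro tendsto_intros)
    have "poly C \<midarrow>z\<rightarrow> poly C z" by (intro tendsto_intros)
    then show "filterlim (poly C) (at 0) (at z)"
      using C(1) eventually_poly_nz_at[OF C(2)] by (simp add: filterlim_at)
  qed (use A in auto)
  then have "is_pole f z"
    unfolding is_pole_def using filterlim_cong[OF refl refl f] by simp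
  moreover have "zorder f z = - int (order z C)"
    using zorder_poly_quotient[OF \<open>A \<noteq> 0\<close> C(2) f] A by (simp add: order_0I)
  ultimately show ?thesis by (simp add: local_degree_def)
qed

text \<open>
  Away from the poles the Wronskian does not change when the value of the quotient at \<open>z\<close> is
  subtracted, and at a pole it only changes its sign when numerator and denominator are swapped.
  In both cases \<open>order_wronskian\<close> applies to a numerator that vanishes at \<open>z\<close>.
\<close>

lemma local_degree_poly_quotient:
  fixes A C :: "complex poly"
  assumes f: "eventually (\<lambda>w. f w = poly A w / poly C w) (at z)"
    and nz: "poly A z \<noteq> 0 \<or> poly C z \<noteq> 0"
    and W: "pderiv A * C - A * pderiv C \<noteq> 0"
  shows "local_degree f z = Suc (order z (pderiv A * C - A * pderiv C))"
proof -
  have AC: "A \<noteq> 0" "C \<noteq> 0" using W by auto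
  show ?thesis
  proof (cases "poly C z = 0")
    case True
    then have A0: "poly A z \<noteq> 0" using nz by simp
    have "order z (pderiv A * C - A * pderiv C) = order z (pderiv C * A - C * pderiv A)"
      by (metis minus_diff_eq mult.commute order_uminus)
    then show ?thesis
      using order_wronskian[OF AC(2) True A0] local_degree_pole[OF f A0 True AC(2)] by simp
  next
    case False
    define v where "v = poly A z / poly C z"
    define R where "R = A - smult v C"
    have "(\<lambda>w. poly A w / poly C w) \<midarrow>z\<rightarrow> v"
      unfolding v_def by (intro tendsto_intros False)
    then have lim: "f \<midarrow>z\<rightarrow> v" using filterlim_cong[OF refl refl f] by simp
    then have "\<not> is_pole f z"
      unfolding is_pole_def by (meson at_neq_bot not_tendsto_and_filterlim_at_infinity)
    moreover have "Lim (at z) f = v" using lim by (simp add: tendsto_Lim)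
    moreover have WR: "pderiv R * C - R * pderiv C = pderiv A * C - A * pderiv C"
      by (simp add: R_def pderiv_diff pderiv_smult algebra_simps)
    moreover have R: "R \<noteq> 0" "poly R z = 0"
      using W False by (auto simp: WR[symmetric]) (simp add: R_def v_def)
    moreover have "eventually (\<lambda>w. poly C w \<noteq> 0) (at z)"
      using False by (intro tendsto_imp_eventually_ne[of _ "poly C z"] tendsto_intros)
    then have "eventually (\<lambda>w. f w - v = poly R w / poly C w) (at z)"
      using f by eventually_elim (simp add: R_def field_simps)
    from zorder_poly_quotient[OF R(1) AC(2) this] have "zorder (\<lambda>w. f w - v) z = int (order z R)"
      using False by (simp add: order_0I)
    ultimately show ?thesis
      using order_wronskian[OF R False] by (simp add: local_degree_def)
  qed
qed

section \<open>The critical polynomial of a Blaschke product\<close>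

definition zeros_poly :: "complex \<Rightarrow> complex \<Rightarrow> complex poly" where
  "zeros_poly s m = [:m, - s, 1:]"

definition poles_poly :: "complex \<Rightarrow> complex \<Rightarrow> complex poly" where
  "poles_poly s m = [:1, - cnj s, cnj m:]"

text \<open>
  The quartic \<open>N\<close> in \<open>B' = \<tau> z\<^sup>2 N / Q\<^sup>2\<close>, that is \<open>3 P Q + z (P' Q - P Q')\<close>; see
  \<open>wronskian_eq_crit_poly\<close>.
\<close>

definition crit_poly :: "complex \<Rightarrow> complex \<Rightarrow> complex poly" where
  "crit_poly s m = [:3 * m, - (4 * s + 2 * cnj s * m), 5 + 3 * (s * cnj s) + m * cnj m,
     - (4 * cnj s + 2 * s * cnj m), 3 * cnj m:]"

lemma poly_zeros_poly: "poly (zeros_poly (p + q) (p * q)) z = (z - p) * (z - q)"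
  by (simp add: zeros_poly_def algebra_simps)

lemma poly_poles_poly: "poly (poles_poly (p + q) (p * q)) z = (1 - cnj p * z) * (1 - cnj q * z)"
  by (simp add: poles_poly_def algebra_simps)

lemma blaschke_eq_poly_quotient:
  "blaschke \<tau> p q z = poly (smult \<tau> (monom 1 3 * zeros_poly (p + q) (p * q))) z
     / poly (poles_poly (p + q) (p * q)) z"
  by (simp add: blaschke_def poly_zeros_poly poly_poles_poly poly_monom)

lemma wronskian_eq_crit_poly:
  "pderiv (smult \<tau> (monom 1 3 * zeros_poly s m)) * poles_poly s m
     - smult \<tau> (monom 1 3 * zeros_poly s m) * pderiv (poles_poly s m)
   = smult \<tau> (monom 1 2 * crit_poly s m)"
  by (simp add: monom_altdef numeral_eq_Suc zeros_poly_def poles_poly_def crit_poly_def pderiv_pCons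
      algebra_simps)

lemma cnj_mult_ne_1:
  assumes "norm a > 1" "norm b > 1"
  shows "cnj a * b \<noteq> 1"
proof
  assume "cnj a * b = 1"
  then have "norm a * norm b = 1" by (metis complex_mod_cnj norm_mult norm_one)
  with assms show False using less_1_mult[of "norm a" "norm b"] by simp
qed

lemma crit_poly_0: "poly (crit_poly s m) 0 = 3 * m"
  by (simp add: crit_poly_def)

lemma crit_mult_blaschke_finite:
  assumes "norm \<tau> = 1" "norm p > 1" "norm q > 1"
  shows "crit_mult (blaschke \<tau> p q) (Some z)
    = (if z = 0 then 2 else 0) + order z (crit_poly (p + q) (p * q))"
proof -
  define A where "A = smult \<tau> (monom 1 3 * zeros_poly (p + q) (p * q))"
  define C where "C = poles_poly (p + q) (p * q)"
  define N where "N = crit_poly (p + q) (p * q)"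
  have "\<tau> \<noteq> 0" "p \<noteq> 0" "q \<noteq> 0" using assms by auto
  then have "N \<noteq> 0" using crit_poly_0[of "p + q" "p * q"] by (auto simp: N_def)
  have W: "pderiv A * C - A * pderiv C = smult \<tau> (monom 1 2 * N)"
    unfolding A_def C_def N_def by (rule wronskian_eq_crit_poly)
  have "poly A z \<noteq> 0 \<or> poly C z \<noteq> 0"
    using \<open>\<tau> \<noteq> 0\<close> cnj_mult_ne_1[OF assms(2,2)] cnj_mult_ne_1[OF assms(2,3)]
      cnj_mult_ne_1[OF assms(3,2)] cnj_mult_ne_1[OF assms(3,3)]
    by (auto simp: A_def C_def poly_monom poly_zeros_poly poly_poles_poly)
  then have "local_degree (blaschke \<tau> p q) z = Suc (order z (smult \<tau> (monom 1 2 * N)))"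
    using local_degree_poly_quotient[of "blaschke \<tau> p q" A C z, unfolded W] \<open>\<tau> \<noteq> 0\<close> \<open>N \<noteq> 0\<close>
    by (simp add: blaschke_eq_poly_quotient flip: A_def C_def)
  also have "order z (smult \<tau> (monom 1 2 * N)) = order z (monom 1 2 :: complex poly) + order z N"
    using \<open>\<tau> \<noteq> 0\<close> \<open>N \<noteq> 0\<close> by (simp add: order_smult order_mult)
  also have "order z (monom 1 2 :: complex poly) = (if z = 0 then 2 else 0)"
    by (simp add: order_0I poly_monom)
  finally show ?thesis by (simp add: crit_mult_def N_def)
qed

lemma crit_mult_blaschke_infinity:
  assumes "norm \<tau> = 1" "norm p > 1" "norm q > 1"
  shows "crit_mult (blaschke \<tau> p q) None = 2"
proof -
  define A where "A = smult \<tau> ([:1, - p:] * [:1, - q:])"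
  define C' where "C' = [:- cnj p, 1:] * [:- cnj q, 1:]"
  define C where "C = monom 1 3 * C'"
  have nz: "\<tau> \<noteq> 0" "p \<noteq> 0" "q \<noteq> 0" using assms by auto
  have factor: "(inverse w - a) / (1 - cnj a * inverse w) = (1 - a * w) / (w - cnj a)"
    if "w \<noteq> 0" for w a :: complex
  proof -
    have "w * (inverse w - a) = 1 - a * w" "w * (1 - cnj a * inverse w) = w - cnj a"
      using that by (simp_all add: algebra_simps)
    then show ?thesis
      using that mult_divide_mult_cancel_left[of w "inverse w - a" "1 - cnj a * inverse w"] by simp
  qed
  have "poly A w = \<tau> * ((1 - p * w) * (1 - q * w))" "poly C w = w^3 * ((w - cnj p) * (w - cnj q))"
    for w by (simp_all add: A_def C_def C'_def poly_monom algebra_simps)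
  then have "blaschke \<tau> p q (inverse w) = poly A w / poly C w" if "w \<noteq> 0" for w
    unfolding blaschke_def factor[OF that] by (simp add: divide_inverse power_inverse)
  then have "eventually (\<lambda>w. blaschke \<tau> p q (inverse w) = poly A w / poly C w) (at 0)"
    by (auto simp: eventually_at_filter)
  moreover have "poly C' 0 \<noteq> 0" using nz by (simp add: C'_def)
  moreover from this have "C' \<noteq> 0" by auto
  moreover from calculation have "order 0 C = 3" by (simp add: C_def order_mult order_0I)
  ultimately show ?thesis
    using local_degree_pole[of "\<lambda>w. blaschke \<tau> p q (inverse w)" A C 0] nz
    by (simp add: crit_mult_def A_def C_def poly_monom)
qed

text \<open>
  The double critical points at \<open>0\<close> and \<open>\<infinity>\<close> are common to all the maps \<open>B\<close>, so the prescribed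
  critical divisor only constrains the roots of the quartic.
\<close>

lemma critical_points_iff_proots:
  assumes "norm \<tau> = 1" "norm p > 1" "norm q > 1"
  shows "(\<forall>x. crit_mult (blaschke \<tau> p q) x
      = count {#Some 0, Some 0, None, None, Some a, Some b, Some c, Some d#} x)
    \<longleftrightarrow> proots (crit_poly (p + q) (p * q)) = {#a, b, c, d#}"
proof -
  have "p * q \<noteq> 0" using assms by auto
  then have "crit_poly (p + q) (p * q) \<noteq> 0" using crit_poly_0[of "p + q" "p * q"] by auto
  then have "crit_mult (blaschke \<tau> p q) (Some z)
      = (if z = 0 then 2 else 0) + count (proots (crit_poly (p + q) (p * q))) z" for z
    using crit_mult_blaschke_finite[OF assms] by simp
  moreover have "count {#Some 0, Some 0, None, None, Some a, Some b, Some c, Some d#} (Some z)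
      = (if z = 0 then 2 else 0) + count {#a, b, c, d#} z" for z
    by simp
  ultimately show ?thesis
    using crit_mult_blaschke_infinity[OF assms]
    by (simp add: split_option_all multiset_eq_iff del: count_add_mset) simp
qed

lemma proots_eq_iff_smult:
  fixes A B :: "complex poly"
  assumes "A \<noteq> 0" "B \<noteq> 0"
  shows "proots A = proots B \<longleftrightarrow> (\<exists>l. A = smult l B)"
proof
  assume "proots A = proots B"
  define R where "R = (\<Prod>x\<in>#proots A. [:- x, 1:])"
  have "A = smult (lead_coeff A) R" "B = smult (lead_coeff B) R"
    using complex_poly_decompose_multiset[of A] complex_poly_decompose_multiset[of B]
      \<open>proots A = proots B\<close> by (simp_all add: R_def)
  then have "A = smult (lead_coeff A / lead_coeff B) B"
    by (metis assms(2) leading_coeff_0_iff nonzero_eq_divide_eq smult_smult)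
  then show "\<exists>l. A = smult l B" ..
qed (use assms in auto)

section \<open>Behaviour on the unit circle\<close>

definition mirror_poly :: "complex \<Rightarrow> complex \<Rightarrow> complex poly" where
  "mirror_poly \<sigma> \<mu> = zeros_poly \<sigma> \<mu> * poles_poly \<sigma> \<mu>"

lemma mirror_poly_coeffs:
  "mirror_poly \<sigma> \<mu> = [:\<mu>, - (\<sigma> + cnj \<sigma> * \<mu>), 1 + \<sigma> * cnj \<sigma> + \<mu> * cnj \<mu>,
     - (cnj \<sigma> + \<sigma> * cnj \<mu>), cnj \<mu>:]"
  by (simp add: mirror_poly_def zeros_poly_def poles_poly_def algebra_simps)

lemma proots_mirror_poly:
  assumes "c \<noteq> 0" "d \<noteq> 0"
  shows "proots (mirror_poly (c + d) (c * d)) = {#c, d, 1 / cnj c, 1 / cnj d#}"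
proof -
  have 1: "proots [:1, - cnj w:] = {#1 / cnj w#}" if "w \<noteq> 0" for w
  proof -
    have "[:1, - cnj w:] = smult (- cnj w) [:- (1 / cnj w), 1:]" using that by simp
    then show ?thesis using that by (metis complex_cnj_zero_iff neg_equal_0_iff_equal proots_smult
          proots_linear_factor minus_minus)
  qed
  have "zeros_poly (c + d) (c * d) = [:- c, 1:] * [:- d, 1:]"
    "poles_poly (c + d) (c * d) = [:1, - cnj c:] * [:1, - cnj d:]"
    by (simp_all add: zeros_poly_def poles_poly_def algebra_simps)
  then show ?thesis using assms
    by (simp add: mirror_poly_def proots_mult 1 del: mult_pCons_left mult_pCons_right)
qed

lemma of_real_norm_sq: "(of_real (norm z))^2 = z * cnj z"
  by (metis complex_norm_square of_real_power)

text \<open>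
  On the unit circle \<open>1 - cnj c * z = z * cnj (z - c)\<close>. This turns self-reciprocal polynomials into
  real functions times a power of \<open>z\<close>.
\<close>

lemma reflected_factor_unit_circle:
  assumes "norm z = 1"
  shows "(z - c) * (1 - cnj c * z) = z * of_real ((norm (z - c))^2)"
proof -
  have "z * cnj z = 1" using assms by (simp flip: complex_norm_square)
  then show ?thesis by (simp add: of_real_norm_sq) algebra
qed

lemma mirror_poly_unit_circle:
  assumes "norm z = 1"
  shows "poly (mirror_poly (c + d) (c * d)) z = z^2 * of_real ((norm (z - c))^2 * (norm (z - d))^2)"
proof -
  have "poly (mirror_poly (c + d) (c * d)) z
      = ((z - c) * (1 - cnj c * z)) * ((z - d) * (1 - cnj d * z))"
    by (simp add: mirror_poly_def poly_zeros_poly poly_poles_poly)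
  then show ?thesis
    using assms by (simp add: reflected_factor_unit_circle power2_eq_square)
qed

text \<open>
  The real function \<open>N / z\<^sup>2\<close> on the unit circle, where it equals the derivative of the argument of
  \<open>B\<close> times \<open>(norm (z - p))\<^sup>2 * (norm (z - q))\<^sup>2\<close>.
\<close>

definition crit_density :: "complex \<Rightarrow> complex \<Rightarrow> complex \<Rightarrow> real" where
  "crit_density p q z = 3 * (norm (z - p))^2 * (norm (z - q))^2
     - ((norm p)^2 - 1) * (norm (z - q))^2 - ((norm q)^2 - 1) * (norm (z - p))^2"

lemma crit_poly_unit_circle:
  assumes "norm z = 1"
  shows "poly (crit_poly (p + q) (p * q)) z = z^2 * of_real (crit_density p q z)"
proof -
  have "poly (crit_poly (p + q) (p * q)) z =
     3 * ((z - p) * (1 - cnj p * z)) * ((z - q) * (1 - cnj q * z))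
     - z * (p * cnj p - 1) * ((z - q) * (1 - cnj q * z))
     - z * (q * cnj q - 1) * ((z - p) * (1 - cnj p * z))"
    unfolding crit_poly_def by (simp add: algebra_simps power2_eq_square)
  also have "\<dots> = z^2 * (3 * of_real ((norm (z - p))^2) * of_real ((norm (z - q))^2)
      - (p * cnj p - 1) * of_real ((norm (z - q))^2) - (q * cnj q - 1) * of_real ((norm (z - p))^2))"
    unfolding reflected_factor_unit_circle[OF assms] by algebra
  finally show ?thesis by (simp add: of_real_norm_sq crit_density_def)
qed

lemma crit_density_commute: "crit_density p q z = crit_density q p z"
  by (simp add: crit_density_def)

text \<open>
  At the point of the circle closest to \<open>p\<close>, the factor at \<open>p\<close> alone turns the argument of \<open>B\<close>
  back at rate \<open>(norm p + 1) / (norm p - 1) \<ge> 3\<close>, at least as fast as \<open>z\<^sup>3\<close>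
  turns it forward, and the factor at \<open>q\<close> turns it further back.
\<close>

lemma crit_density_neg:
  assumes "norm p > 1" "norm p \<le> 2" "norm q > 1"
  obtains z where "norm z = 1" "crit_density p q z < 0"
proof -
  define z where "z = p / of_real (norm p)"
  have "p \<noteq> 0" using assms by auto
  then have z: "norm z = 1" by (simp add: z_def norm_divide)
  have "p = of_real (norm p) * z" using \<open>p \<noteq> 0\<close> by (simp add: z_def)
  then have "z - p = of_real (1 - norm p) * z" by (simp add: algebra_simps)
  then have zp: "norm (z - p) = norm p - 1"
    using assms z by (simp only: norm_mult norm_of_real) simp
  have "crit_density p q z = (norm (z - q))^2 * ((norm p - 1) * (2 * norm p - 4))
      - ((norm q)^2 - 1) * (norm p - 1)^2"
    unfolding crit_density_def zp by (simp add: algebra_simps power2_eq_square)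
  also have "\<dots> < 0"
  proof -
    have "(norm (z - q))^2 * ((norm p - 1) * (2 * norm p - 4)) \<le> 0"
      using assms by (intro mult_nonneg_nonpos) auto
    moreover have "((norm q)^2 - 1) * (norm p - 1)^2 > 0"
      using assms by (intro mult_pos_pos) (auto simp: one_less_power)
    ultimately show ?thesis by linarith
  qed
  finally show ?thesis using that z by blast
qed

lemma vieta_quadratic:
  fixes s m :: complex
  obtains p q where "p + q = s" "p * q = m"
proof
  let ?d = "csqrt (s^2 - 4 * m)"
  show "(s + ?d) / 2 + (s - ?d) / 2 = s" by (simp add: field_simps)
  have "(s + ?d) / 2 * ((s - ?d) / 2) = (s^2 - ?d^2) / 4" by (simp add: field_simps power2_eq_square)
  then show "(s + ?d) / 2 * ((s - ?d) / 2) = m" by simp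
qed

text \<open>
  For \<open>norm (p * q) > 1\<close>, the sign of the left side decides whether \<open>p\<close> and \<open>q\<close> lie on the same side
  of the unit circle, in terms of their symmetric functions alone.
\<close>

lemma schur_cohn_identity:
  "((norm (p * q))^2 - 1)^2 - (norm (cnj (p * q) * (p + q) - cnj (p + q)))^2
     = ((norm p)^2 - 1) * ((norm q)^2 - 1) * (norm (1 - cnj p * q))^2"
proof -
  have "of_real (((norm (p * q))^2 - 1)^2 - (norm (cnj (p * q) * (p + q) - cnj (p + q)))^2)
     = (of_real (((norm p)^2 - 1) * ((norm q)^2 - 1) * (norm (1 - cnj p * q))^2) :: complex)"
    by (simp add: of_real_norm_sq del: norm_mult) algebra
  then show ?thesis by (simp only: of_real_eq_iff)
qed

section \<open>A convex equation under a side condition\<close>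

text \<open>
  The set \<open>{D > 0}\<close> need not be an interval. Still, to the left of each of its points there is a
  negative value of \<open>G\<close>, at a zero of \<open>D\<close> or at the end point \<open>a\<close>; to the right of each point outside
  of it there is a negative value too. By convexity \<open>G\<close> stays negative between a negative and a
  nonpositive value. So a zero to the right of a negative value cannot lie where \<open>D \<le> 0\<close>, and a
  zero where \<open>D > 0\<close> cannot be followed by another one.
\<close>

lemma ex1_zero_convex_constrained:
  fixes G D :: "real \<Rightarrow> real"
  assumes conv: "convex_on {a..} G"
    and contG: "continuous_on {a..} G" and contD: "continuous_on {a..} D"
    and evG: "eventually (\<lambda>r. G r > 0) at_top" and evD: "eventually (\<lambda>r. D r > 0) at_top"
    and bdry: "\<And>r. r \<ge> a \<Longrightarrow> D r = 0 \<Longrightarrow> G r < 0"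
    and left: "D a > 0 \<Longrightarrow> G a < 0"
  shows "\<exists>!r. r > a \<and> G r = 0 \<and> D r > 0"
proof -
  have between: "G r1 < 0" if "a \<le> r0" "r0 < r1" "r1 < r2" "G r0 < 0" "G r2 \<le> 0" for r0 r1 r2
  proof -
    define t where "t = (r1 - r0) / (r2 - r0)"
    have t: "0 < t" "t < 1" "r1 = (1 - t) *\<^sub>R r0 + t *\<^sub>R r2"
    proof -
      have "t * (r2 - r0) = r1 - r0" using that by (simp add: t_def)
      then show "r1 = (1 - t) *\<^sub>R r0 + t *\<^sub>R r2" by (simp add: algebra_simps)
    qed (use that in \<open>simp_all add: t_def\<close>)
    have "G r1 \<le> (1 - t) * G r0 + t * G r2"
      using convex_onD[OF conv, of t r0 r2] t that by simp
    also have "\<dots> < 0"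
      using mult_pos_neg[of "1 - t" "G r0"] mult_nonneg_nonpos[of t "G r2"] t that by simp
    finally show ?thesis .
  qed
  have neg_left: "\<exists>r0\<ge>a. r0 \<le> r \<and> G r0 < 0" if r: "r \<ge> a" "D r > 0" for r
  proof (cases "D a > 0")
    case True
    with left that show ?thesis by blast
  next
    case False
    moreover have "continuous_on {a..r} D" using contD by (rule continuous_on_subset) auto
    ultimately obtain r0 where "a \<le> r0" "r0 \<le> r" "D r0 = 0"
      using IVT'[of D a 0 r] r by (auto simp: not_less less_imp_le)
    with bdry show ?thesis by blast
  qed
  have neg_right: "\<exists>r2\<ge>r. G r2 < 0" if r: "r \<ge> a" "D r \<le> 0" for r
  proof -
    obtain R where R: "R \<ge> r" "D R > 0"
      using eventually_happens'[OF _ eventually_conj[OF evD eventually_ge_at_top[of r]]] by auto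
    have "continuous_on {r..R} D" using contD by (rule continuous_on_subset) (use that in auto)
    then obtain r2 where "r \<le> r2" "D r2 = 0"
      using IVT'[of D r 0 R] r R by (auto simp: less_imp_le)
    with bdry[of r2] that show ?thesis by force
  qed
  show ?thesis
  proof (rule ex_ex1I)
    obtain R where R: "R \<ge> a" "D R > 0" "G R > 0"
      using eventually_happens'[OF _ eventually_conj[OF eventually_conj[OF evD evG] eventually_ge_at_top[of a]]]
      by auto
    with neg_left obtain r0 where r0: "a \<le> r0" "r0 \<le> R" "G r0 < 0" by blast
    have "continuous_on {r0..R} G" using contG by (rule continuous_on_subset) (use r0 in auto)
    then obtain r1 where r1: "r0 \<le> r1" "r1 \<le> R" "G r1 = 0"
      using IVT'[of G r0 0 R] r0 R by (auto simp: less_imp_le)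
    then have "r0 < r1" using r0 by (cases "r0 = r1") auto
    moreover have "D r1 > 0"
    proof (rule ccontr)
      assume "\<not> D r1 > 0"
      with neg_right[of r1] r0 r1 obtain r2 where "r2 \<ge> r1" "G r2 < 0" by force
      with r1 have "r1 < r2" by (cases "r1 = r2") auto
      with between[of r0 r1 r2] \<open>r0 < r1\<close> \<open>G r2 < 0\<close> r0 r1 show False by simp
    qed
    ultimately show "\<exists>r. r > a \<and> G r = 0 \<and> D r > 0" using r0 r1 by force
  next
    have "\<not> r < r'" if "r > a \<and> G r = 0 \<and> D r > 0" "r' > a \<and> G r' = 0 \<and> D r' > 0" for r r'
    proof
      assume "r < r'"
      obtain r0 where r0: "a \<le> r0" "r0 \<le> r" "G r0 < 0" using neg_left[of r] \<open>r > a \<and> _\<close> by auto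
      then have "r0 < r" using that by (cases "r0 = r") auto
      with between[of r0 r r'] \<open>r < r'\<close> r0 that show False by simp
    qed
    then show "r = r'" if "r > a \<and> G r = 0 \<and> D r > 0" "r' > a \<and> G r' = 0 \<and> D r' > 0" for r r'
      using that by (meson linorder_neqE_linordered_idom)
  qed
qed

text \<open>
  The difference of the two sides of the equation for the middle coefficient, divided by \<open>r\<close>.
  Here \<open>A\<close> and \<open>C\<close> are nonnegative multiples of the squared real and imaginary parts of \<open>c1 + c2\<close>
  after the rotation that makes \<open>c1 * c2\<close> positive.
\<close>

definition excess :: "real \<Rightarrow> real \<Rightarrow> real \<Rightarrow> real \<Rightarrow> real" where
  "excess A C \<kappa> r = r + 5 / r + A * (r / (r + 2)^2) + C * (r / (r - 2)^2) - \<kappa>"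

text \<open>
  The end point 4 is where the second derivative of \<open>r / (r + 2)\<^sup>2\<close> changes sign.
\<close>

lemma convex_on_excess:
  assumes "A \<ge> 0" "C \<ge> 0"
  shows "convex_on {4..} (excess A C \<kappa>)"
proof (rule f''_ge0_imp_convex)
  fix r :: real assume "r \<in> {4..}"
  then have r: "r \<ge> 4" "r + 2 \<noteq> 0" "r - 2 \<noteq> 0" "r \<noteq> 0" by auto
  show "(excess A C \<kappa> has_real_derivative
      1 - 5 / r^2 + A * ((2 - r) / (r + 2)^3) + C * (- (r + 2) / (r - 2)^3)) (at r)"
  proof -
    have d1: "((\<lambda>r. r / (r + 2)^2) has_real_derivative (2 - r) / (r + 2)^3) (at r)"
      by (rule derivative_eq_intros refl | use r in force)+
         (use r in \<open>simp add: divide_simps, algebra\<close>)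
    have d2: "((\<lambda>r. r / (r - 2)^2) has_real_derivative - (r + 2) / (r - 2)^3) (at r)"
      by (rule derivative_eq_intros refl | use r in force)+
         (use r in \<open>simp add: divide_simps, algebra\<close>)
    show ?thesis
      unfolding excess_def
      by (rule d1 d2 derivative_eq_intros refl | use r in force)+
         (use r in \<open>simp add: power2_eq_square mult.commute\<close>)
  qed
  show "((\<lambda>r. 1 - 5 / r^2 + A * ((2 - r) / (r + 2)^3) + C * (- (r + 2) / (r - 2)^3))
      has_real_derivative 10 / r^3 + A * ((2 * r - 8) / (r + 2)^4) + C * ((2 * r + 8) / (r - 2)^4)) (at r)"
  proof -
    have d1: "((\<lambda>r. (2 - r) / (r + 2)^3) has_real_derivative (2 * r - 8) / (r + 2)^4) (at r)"
      by (rule derivative_eq_intros refl | use r in force)+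
         (use r in \<open>simp add: divide_simps, algebra\<close>)
    have d2: "((\<lambda>r. - (r + 2) / (r - 2)^3) has_real_derivative (2 * r + 8) / (r - 2)^4) (at r)"
      by (rule derivative_eq_intros refl | use r in force)+
         (use r in \<open>simp add: divide_simps, algebra\<close>)
    show ?thesis
      by (rule d1 d2 derivative_eq_intros refl | use r in force)+
         (use r in \<open>simp add: divide_simps, algebra?\<close>)
  qed
  show "10 / r^3 + A * ((2 * r - 8) / (r + 2)^4) + C * ((2 * r + 8) / (r - 2)^4) \<ge> 0"
    using r assms by (intro add_nonneg_nonneg mult_nonneg_nonneg divide_nonneg_nonneg) auto
qed auto

text \<open>
  The left side of \<open>schur_cohn_identity\<close> in the same coordinates, with \<open>A\<close> and \<open>C\<close> one third of their
  values in \<open>excess\<close>.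
\<close>

definition schur_margin :: "real \<Rightarrow> real \<Rightarrow> real \<Rightarrow> real" where
  "schur_margin A C r = (r^2 - 1)^2 - A * ((r - 1) * r / (r + 2))^2 - C * ((r + 1) * r / (r - 2))^2"

lemma eventually_excess_pos: "eventually (\<lambda>r. excess A C \<kappa> r > 0) at_top"
proof -
  have 1: "((\<lambda>r::real. r / (r + 2)^2) \<longlongrightarrow> 0) at_top" "((\<lambda>r::real. r / (r - 2)^2) \<longlongrightarrow> 0) at_top"
    "((\<lambda>r::real. 5 / r) \<longlongrightarrow> 0) at_top"
    by real_asymp+
  have "((\<lambda>r. 5 / r + A * (r / (r + 2)^2) + C * (r / (r - 2)^2) - \<kappa>) \<longlongrightarrow> 0 + A * 0 + C * 0 - \<kappa>) at_top"
    by (intro tendsto_intros 1)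
  from filterlim_tendsto_add_at_top[OF this filterlim_ident]
  have "filterlim (excess A C \<kappa>) at_top at_top"
    by (simp add: excess_def[abs_def] algebra_simps)
  then show ?thesis by (simp add: filterlim_at_top_dense)
qed

lemma eventually_schur_margin_pos: "eventually (\<lambda>r. schur_margin A C r > 0) at_top"
proof -
  have 1: "((\<lambda>r::real. (r^2 - 1)^2 / r^4) \<longlongrightarrow> 1) at_top"
    "((\<lambda>r::real. ((r - 1) * r / (r + 2))^2 / r^4) \<longlongrightarrow> 0) at_top"
    "((\<lambda>r::real. ((r + 1) * r / (r - 2))^2 / r^4) \<longlongrightarrow> 0) at_top"
    by real_asymp+
  have "((\<lambda>r. (r^2 - 1)^2 / r^4 - A * (((r - 1) * r / (r + 2))^2 / r^4)
      - C * (((r + 1) * r / (r - 2))^2 / r^4)) \<longlongrightarrow> 1 - A * 0 - C * 0) at_top"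
    by (intro tendsto_intros 1)
  then have "((\<lambda>r. schur_margin A C r / r^4) \<longlongrightarrow> 1) at_top"
    by (simp add: schur_margin_def diff_divide_distrib)
  then have "eventually (\<lambda>r. schur_margin A C r / r^4 > 0) at_top"
    by (rule order_tendstoD) simp
  then show ?thesis
    using eventually_gt_at_top[of 0] by eventually_elim (simp add: zero_less_divide_iff)
qed

lemma continuous_on_excess: "continuous_on {4..} (excess A C \<kappa>)"
  unfolding excess_def by (intro continuous_intros) auto

lemma continuous_on_schur_margin: "continuous_on {4..} (schur_margin A C)"
  unfolding schur_margin_def by (intro continuous_intros) auto

section \<open>Matching the coefficients\<close>

locale critical_points =
  fixes c1 c2 :: complex
  assumes c1: "norm c1 > 1" and c2: "norm c2 > 1"
begin

text \<open>
  The rotation by \<open>e\<close> makes \<open>c1 * c2\<close> equal to the positive number \<open>M\<close> and \<open>c1 + c2\<close> equal to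
  \<open>Complex a b\<close>. The equations for \<open>s\<close> then separate into real and imaginary parts.
\<close>

definition M :: real where "M = norm (c1 * c2)"
definition e :: complex where "e = csqrt (c1 * c2 / of_real M)"
definition a :: real where "a = Re ((c1 + c2) / e)"
definition b :: real where "b = Im ((c1 + c2) / e)"
definition kx :: real where "kx = 3 * (M + 1) * a / (2 * M)"
definition ky :: real where "ky = 3 * (M - 1) * b / (2 * M)"
definition \<kappa> :: real where "\<kappa> = 3 * (1 + a^2 + b^2 + M^2) / M"

text \<open>
  The values of \<open>p + q\<close> and \<open>p * q\<close> which are forced on a solution with \<open>norm (p * q) = r\<close> by all
  coefficients except the middle one. The pole at \<open>r = 2\<close> is where the linear system for \<open>p + q\<close>
  degenerates.
\<close>

definition zsum :: "real \<Rightarrow> complex" where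
  "zsum r = e * Complex (kx * (r / (r + 2))) (ky * (r / (r - 2)))"

definition zprod :: "real \<Rightarrow> complex" where
  "zprod r = e^2 * of_real r"

abbreviation G :: "real \<Rightarrow> real" where "G \<equiv> excess (3 * kx^2) (3 * ky^2) \<kappa>"
abbreviation D :: "real \<Rightarrow> real" where "D \<equiv> schur_margin (kx^2) (ky^2)"

lemma M_pos: "M > 1"
  using less_1_mult[OF c1 c2] by (simp add: M_def norm_mult)

lemma e_sq: "e^2 = c1 * c2 / of_real M"
  by (simp add: e_def)

lemma norm_e: "norm e = 1"
proof -
  have "(norm e)^2 = 1" using M_pos by (simp flip: norm_power add: e_sq norm_divide) (simp add: M_def)
  then show ?thesis by (simp add: power2_eq_1_iff)
    (metis abs_norm_cancel abs_neg_one norm_ge_zero not_one_le_zero neg_0_le_iff_le)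
qed

lemma e_cnj: "e * cnj e = 1"
  using norm_e by (simp flip: complex_norm_square)

lemma prod_eq: "c1 * c2 = e^2 * of_real M"
  using M_pos by (simp add: e_sq)

lemma sum_eq: "c1 + c2 = e * Complex a b"
  using e_cnj by (auto simp: a_def b_def)

lemma rotate_linear:
  "of_real j * (e * Complex x y) + of_real k * cnj (e * Complex x y) * (e^2 * of_real r)
    = e * Complex ((j + k * r) * x) ((j - k * r) * y)"
proof -
  have "of_real j * (e * Complex x y) + of_real k * cnj (e * Complex x y) * (e^2 * of_real r)
    = e * (of_real j * Complex x y + of_real (k * r) * cnj (Complex x y))"
    using e_cnj unfolding complex_cnj_mult of_real_mult by algebra
  also have "of_real j * Complex x y + of_real (k * r) * cnj (Complex x y)
      = Complex ((j + k * r) * x) ((j - k * r) * y)"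
    by (simp add: complex_eq_iff algebra_simps)
  finally show ?thesis .
qed

lemma rotate_norm_sq:
  "e * Complex x y * cnj (e * Complex x y) = of_real (x^2 + y^2)"
  "e^2 * of_real r * cnj (e^2 * of_real r) = of_real (r^2)"
  unfolding complex_norm_square[symmetric]
  by (simp_all add: norm_mult norm_power norm_e cmod_power2)

lemma crit_poly_rotate:
  "crit_poly (e * Complex x y) (e^2 * of_real r) =
    [:3 * (e^2 * of_real r), - (e * Complex ((4 + 2 * r) * x) ((4 - 2 * r) * y)),
      of_real (5 + 3 * (x^2 + y^2) + r^2),
      - (cnj e * Complex ((4 + 2 * r) * x) (- ((4 - 2 * r) * y))), 3 * (cnj e^2 * of_real r):]"
proof -
  define s m where "s = e * Complex x y" and "m = e^2 * of_real r"
  have 1: "4 * s + 2 * cnj s * m = e * Complex ((4 + 2 * r) * x) ((4 - 2 * r) * y)"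
    using rotate_linear[of 4 x y 2 r] by (simp add: s_def m_def)
  then have "cnj (4 * s + 2 * cnj s * m) = cnj (e * Complex ((4 + 2 * r) * x) ((4 - 2 * r) * y))"
    by (rule arg_cong)
  then have 3: "4 * cnj s + 2 * s * cnj m
      = cnj e * Complex ((4 + 2 * r) * x) (- ((4 - 2 * r) * y))"
    by (simp add: complex_eq_iff)
  have 2: "5 + 3 * (s * cnj s) + m * cnj m = of_real (5 + 3 * (x^2 + y^2) + r^2)"
    unfolding s_def m_def rotate_norm_sq by simp
  have 4: "cnj m = cnj e^2 * of_real r" by (simp add: m_def)
  show ?thesis
    unfolding s_def[symmetric] m_def[symmetric] crit_poly_def 1 2 3
    unfolding 4 by (simp only: m_def)
qed

lemma mirror_poly_rotate:
  "mirror_poly (c1 + c2) (c1 * c2) =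
    [:e^2 * of_real M, - (e * Complex ((1 + M) * a) ((1 - M) * b)),
      of_real (1 + a^2 + b^2 + M^2),
      - (cnj e * Complex ((1 + M) * a) (- ((1 - M) * b))), cnj e^2 * of_real M:]"
proof -
  define s m where "s = e * Complex a b" and "m = e^2 * of_real M"
  have 1: "s + cnj s * m = e * Complex ((1 + M) * a) ((1 - M) * b)"
    using rotate_linear[of 1 a b 1 M] by (simp add: s_def m_def)
  then have "cnj (s + cnj s * m) = cnj (e * Complex ((1 + M) * a) ((1 - M) * b))"
    by (rule arg_cong)
  then have 3: "cnj s + s * cnj m
      = cnj e * Complex ((1 + M) * a) (- ((1 - M) * b))"
    by (simp add: complex_eq_iff)
  have 2: "1 + s * cnj s + m * cnj m = of_real (1 + a^2 + b^2 + M^2)"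
    unfolding s_def m_def rotate_norm_sq by simp
  have 4: "cnj m = cnj e^2 * of_real M" by (simp add: m_def)
  show ?thesis
    unfolding sum_eq prod_eq s_def[symmetric] m_def[symmetric] mirror_poly_coeffs 1 2 3
    unfolding 4 by (simp only: m_def)
qed

lemma linear_system_iff:
  assumes "r > 2"
  shows "(4 + 2 * r) * x = 3 * r / M * ((1 + M) * a) \<longleftrightarrow> x = kx * (r / (r + 2))"
    and "(4 - 2 * r) * y = 3 * r / M * ((1 - M) * b) \<longleftrightarrow> y = ky * (r / (r - 2))"
proof -
  have 1: "3 * r / M * ((1 + M) * a) = (4 + 2 * r) * (kx * (r / (r + 2)))"
    "3 * r / M * ((1 - M) * b) = (4 - 2 * r) * (ky * (r / (r - 2)))"
    using assms M_pos by (simp_all add: kx_def ky_def divide_simps) algebra+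
  have "4 + 2 * r \<noteq> 0" "4 - 2 * r \<noteq> 0" using assms by auto
  then show "(4 + 2 * r) * x = 3 * r / M * ((1 + M) * a) \<longleftrightarrow> x = kx * (r / (r + 2))"
    and "(4 - 2 * r) * y = 3 * r / M * ((1 - M) * b) \<longleftrightarrow> y = ky * (r / (r - 2))"
    unfolding 1 mult_cancel_left by simp_all
qed

lemma Complex_scale:
  "Complex (t * u) (t * v) = of_real t * Complex u v"
  "Complex (t * u) (- (t * v)) = of_real t * Complex u (- v)"
  by (simp_all add: complex_eq_iff)

text \<open>
  \<open>zsum\<close> and \<open>zprod\<close> match all coefficients but the middle one, and \<open>G\<close> measures the mismatch that
  remains.
\<close>

lemma crit_poly_split:
  assumes "r > 2"
  shows "crit_poly (zsum r) (zprod r)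
    = smult (of_real (3 * r / M)) (mirror_poly (c1 + c2) (c1 * c2)) + [:0, 0, of_real (r * G r):]"
proof -
  define t where "t = 3 * r / M"
  have "r * G r = r^2 + 5 + 3 * kx^2 * (r^2 / (r + 2)^2) + 3 * ky^2 * (r^2 / (r - 2)^2) - r * \<kappa>"
    using assms by (simp add: excess_def algebra_simps power2_eq_square)
  moreover have "r * \<kappa> = t * (1 + a^2 + b^2 + M^2)" by (simp add: \<kappa>_def t_def)
  ultimately have 2: "5 + 3 * ((kx * (r / (r + 2)))^2 + (ky * (r / (r - 2)))^2) + r^2
      = t * (1 + a^2 + b^2 + M^2) + r * G r"
    by (simp add: power_mult_distrib power_divide)
  have "t * M = 3 * r" using M_pos by (simp add: t_def)
  then have 3: "of_real t * of_real M = (3 * of_real r :: complex)"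
    by (metis of_real_mult of_real_numeral)
  note 1 = linear_system_iff[OF assms, folded t_def, THEN iffD2, OF refl]
  show ?thesis
    unfolding zsum_def zprod_def crit_poly_rotate mirror_poly_rotate 1 2 t_def[symmetric] Complex_scale
    using 3 by (simp; intro conjI; algebra)
qed

text \<open>
  The extreme coefficients are conjugate on both sides, so the factor is real; the middle
  coefficients are positive on both sides, so it is positive.
\<close>

lemma smult_factor_pos:
  assumes eq: "crit_poly s m = smult l (mirror_poly (c1 + c2) (c1 * c2))"
  obtains t where "l = of_real t" "t > 0"
proof -
  have nz: "c1 * c2 \<noteq> 0" using c1 c2 by auto
  have l1: "3 * m = l * (c1 * c2)" "3 * cnj m = l * cnj (c1 * c2)"
    and l2: "5 + 3 * (s * cnj s) + m * cnj m
      = l * (1 + (c1 + c2) * cnj (c1 + c2) + (c1 * c2) * cnj (c1 * c2))"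
    using eq by (simp_all add: crit_poly_def mirror_poly_coeffs)
  have "cnj (3 * m) = cnj (l * (c1 * c2))" using l1(1) by (rule arg_cong)
  with l1(2) have "l * cnj (c1 * c2) = cnj l * cnj (c1 * c2)" by simp
  with nz have "l = cnj l" by simp
  then obtain t where t: "l = of_real t" by (metis Reals_cnj_iff Reals_cases)
  have "of_real (5 + 3 * (norm s)^2 + (norm m)^2)
      = (of_real (t * (1 + (norm (c1 + c2))^2 + (norm (c1 * c2))^2)) :: complex)"
    using l2 unfolding t
    by (simp only: of_real_add of_real_mult of_real_power of_real_norm_sq of_real_1 of_real_numeral)
  then have "5 + 3 * (norm s)^2 + (norm m)^2 = t * (1 + (norm (c1 + c2))^2 + (norm (c1 * c2))^2)"
    by (simp only: of_real_eq_iff)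
  moreover have "5 + 3 * (norm s)^2 + (norm m)^2 > 0" "1 + (norm (c1 + c2))^2 + (norm (c1 * c2))^2 > 0"
    by (smt (verit) zero_le_power2)+
  ultimately have "t > 0" by (metis zero_less_mult_pos2)
  with t show ?thesis by (rule that)
qed

lemma zeros_coeffs_unique:
  assumes eq: "crit_poly s m = smult l (mirror_poly (c1 + c2) (c1 * c2))" and m: "norm m > 2"
  shows "s = zsum (norm m) \<and> m = zprod (norm m) \<and> G (norm m) = 0"
proof -
  obtain t where t: "l = of_real t" "t > 0" using smult_factor_pos[OF eq] .
  have "e \<noteq> 0" using e_cnj by auto
  define r where "r = t * M / 3"
  have "r > 0" using t(2) M_pos by (simp add: r_def)
  have "3 * m = of_real t * (c1 * c2)"
    using eq t by (simp add: crit_poly_def mirror_poly_coeffs)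
  then have mr: "m = e^2 * of_real r" unfolding prod_eq by (simp add: r_def field_simps)
  then have r: "norm m = r" using \<open>r > 0\<close> by (simp add: norm_mult norm_power norm_e)
  have "r > 2" using m r by simp
  have t_eq: "t = 3 * r / M" using M_pos by (simp add: r_def)
  define x y where "x = Re (s / e)" and "y = Im (s / e)"
  have s: "s = e * Complex x y" using \<open>e \<noteq> 0\<close> by (simp add: x_def y_def)
  have "e * Complex ((4 + 2 * r) * x) ((4 - 2 * r) * y)
      = e * Complex (t * ((1 + M) * a)) (t * ((1 - M) * b))"
    using eq unfolding s mr t(1) crit_poly_rotate mirror_poly_rotate Complex_scale by simp
  then have "x = kx * (r / (r + 2))" "y = ky * (r / (r - 2))"
    using \<open>e \<noteq> 0\<close> linear_system_iff[OF \<open>r > 2\<close>] by (simp_all add: t_eq)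
  then have "s = zsum r" "m = zprod r" by (simp_all add: s mr zsum_def zprod_def)
  moreover from this have "[:0, 0, of_real (r * G r):] = (0 :: complex poly)"
    using eq crit_poly_split[OF \<open>r > 2\<close>] by (simp add: t(1) t_eq)
  then have "G r = 0" using \<open>r > 2\<close> by (simp add: pCons_eq_0_iff)
  ultimately show ?thesis unfolding r by blast
qed

lemma schur_margin_eq:
  assumes "p + q = zsum r" "p * q = zprod r" "r > 2"
  shows "D r = ((norm p)^2 - 1) * ((norm q)^2 - 1) * (norm (1 - cnj p * q))^2"
proof -
  have C: "Complex u v = of_real u + \<i> * of_real v" for u v by (simp add: complex_eq_iff)
  define x y where "x = kx * (r / (r + 2))" and "y = ky * (r / (r - 2))"
  have "cnj (zprod r) * zsum r - cnj (zsum r) = cnj e * Complex ((r - 1) * x) ((r + 1) * y)"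
    unfolding zprod_def zsum_def C x_def[symmetric] y_def[symmetric] using e_cnj
    by (simp add: power2_eq_square) algebra
  then have "(norm (cnj (zprod r) * zsum r - cnj (zsum r)))^2 = ((r - 1) * x)^2 + ((r + 1) * y)^2"
    by (simp add: norm_mult norm_e cmod_power2)
  moreover have "norm (zprod r) = r" using assms by (simp add: zprod_def norm_mult norm_power norm_e)
  moreover have "D r = (r^2 - 1)^2 - (((r - 1) * x)^2 + ((r + 1) * y)^2)"
    by (simp add: schur_margin_def x_def y_def power_mult_distrib power_divide mult_ac)
  ultimately show ?thesis using schur_cohn_identity[of p q] assms by simp
qed

text \<open>
  By \<open>crit_poly_split\<close> the density is \<open>r * G r\<close> plus a positive multiple of \<open>T / z\<^sup>2\<close>, and the latter is
  positive on the unit circle.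
\<close>

lemma excess_neg_if_density:
  assumes "p + q = zsum r" "p * q = zprod r" "r > 2" "norm z = 1" "crit_density p q z \<le> 0"
  shows "G r < 0"
proof -
  let ?t = "(norm (z - c1))^2 * (norm (z - c2))^2"
  have "z \<noteq> c1" "z \<noteq> c2" using c1 c2 assms by auto
  then have "3 * r / M * ?t > 0" using M_pos assms by simp
  moreover have "z^2 * of_real (crit_density p q z) = z^2 * of_real (3 * r / M * ?t + r * G r)"
  proof -
    have "z^2 * of_real (crit_density p q z) = poly (crit_poly (zsum r) (zprod r)) z"
      using crit_poly_unit_circle[of z p q] assms by simp
    also have "\<dots> = of_real (3 * r / M) * (z^2 * of_real ?t) + of_real (r * G r) * z^2"
      unfolding crit_poly_split[OF assms(3)]
      by (simp add: mirror_poly_unit_circle[OF assms(4)] power2_eq_square)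
    finally show ?thesis by (simp add: algebra_simps)
  qed
  then have "crit_density p q z = 3 * r / M * ?t + r * G r"
    using assms(4) by (subst (asm) mult_cancel_left) (auto simp only: of_real_eq_iff, simp)
  ultimately have "r * G r < 0" using assms by linarith
  then show ?thesis using assms by (simp add: mult_less_0_iff)
qed

text \<open>
  A zero of \<open>D\<close> means that one of the zeros \<open>p\<close>, \<open>q\<close> reaches the unit circle, where it cancels
  against a pole and the density vanishes.
\<close>

lemma excess_neg_at_margin_zero:
  assumes "r \<ge> 4" "D r = 0"
  shows "G r < 0"
proof -
  obtain p q where pq: "p + q = zsum r" "p * q = zprod r" by (rule vieta_quadratic)
  have norm_pq: "norm p * norm q = r"
    using assms pq by (simp flip: norm_mult add: zprod_def) (simp add: norm_mult norm_power norm_e)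
  have "cnj p * q \<noteq> 1"
  proof
    assume "cnj p * q = 1"
    then have "norm p * norm q = 1" by (metis complex_mod_cnj norm_mult norm_one)
    with norm_pq assms show False by simp
  qed
  then have "norm p = 1 \<or> norm q = 1"
    using schur_margin_eq[OF pq] assms by (auto simp: power2_eq_1_iff) (smt (verit) norm_ge_zero)+
  then show ?thesis
  proof
    assume "norm p = 1"
    then show ?thesis using pq assms by (intro excess_neg_if_density[of p q r p]) (auto simp: crit_density_def)
  next
    assume "norm q = 1"
    then show ?thesis using pq assms by (intro excess_neg_if_density[of p q r q]) (auto simp: crit_density_def)
  qed
qed

lemma norm_zprod: "norm (zprod r) = \<bar>r\<bar>"
  by (simp add: zprod_def norm_mult norm_power norm_e)

lemma outside_iff:
  assumes "p + q = zsum r" "p * q = zprod r" "r > 2"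
  shows "D r > 0 \<longleftrightarrow> norm p > 1 \<and> norm q > 1"
proof
  have pq: "norm p * norm q = r" using assms norm_zprod[of r] by (simp flip: norm_mult)
  assume "D r > 0"
  then have "((norm p)^2 - 1) * ((norm q)^2 - 1) > 0"
    unfolding schur_margin_eq[OF assms] by (metis zero_le_power2 zero_less_mult_pos2 mult_zero_right less_eq_real_def)
  moreover have "\<not> ((norm p)^2 < 1 \<and> (norm q)^2 < 1)"
  proof
    assume "(norm p)^2 < 1 \<and> (norm q)^2 < 1"
    then have "norm p < 1" "norm q < 1" by (simp_all add: power_less_one_iff abs_square_less_1)
    then have "norm p * norm q < 1 * 1" by (intro mult_strict_mono) auto
    with pq assms show False by simp
  qed
  ultimately have "(norm p)^2 > 1" "(norm q)^2 > 1" by (auto simp: zero_less_mult_iff)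
  then show "norm p > 1 \<and> norm q > 1"
    by (metis norm_ge_zero power2_less_imp_less one_power2)
next
  assume pq: "norm p > 1 \<and> norm q > 1"
  then have "cnj p * q \<noteq> 1" by (intro cnj_mult_ne_1) auto
  with pq show "D r > 0"
    unfolding schur_margin_eq[OF assms] by (intro mult_pos_pos) (auto simp: one_less_power)
qed

text \<open>
  If \<open>p\<close> and \<open>q\<close> are outside the disk and their product has modulus 4, one of them has modulus at
  most 2, and \<open>crit_density_neg\<close> applies.
\<close>

lemma excess_neg_at_4:
  assumes "D 4 > 0"
  shows "G 4 < 0"
proof -
  obtain p q where pq: "p + q = zsum 4" "p * q = zprod 4" by (rule vieta_quadratic)
  then have out: "norm p > 1" "norm q > 1" using outside_iff[OF pq] assms by auto
  have "norm p * norm q = 4" using pq norm_zprod[of 4] by (simp flip: norm_mult)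
  then have "norm p \<le> 2 \<or> norm q \<le> 2"
    using mult_strict_mono[of 2 "norm p" 2 "norm q"] by force
  then obtain z where z: "norm z = 1" "crit_density p q z < 0"
    using out crit_density_neg[of p q] crit_density_neg[of q p] crit_density_commute[of p q] by metis
  then show ?thesis using pq by (intro excess_neg_if_density[of p q 4 z]) auto
qed

lemma ex1_radius: "\<exists>!r. r > 4 \<and> G r = 0 \<and> D r > 0"
  by (rule ex1_zero_convex_constrained[OF convex_on_excess continuous_on_excess
    continuous_on_schur_margin eventually_excess_pos eventually_schur_margin_pos
    excess_neg_at_margin_zero excess_neg_at_4])
     auto

text \<open>
  Since \<open>T / z\<^sup>2\<close> is positive on the unit circle, the density of a solution cannot be negative
  anywhere on it.
\<close>

lemma zeros_far_out:
  assumes "norm p > 1" "norm q > 1"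
    and eq: "crit_poly (p + q) (p * q) = smult l (mirror_poly (c1 + c2) (c1 * c2))"
  shows "norm p > 2"
proof (rule ccontr)
  assume "\<not> norm p > 2"
  then obtain z where z: "norm z = 1" "crit_density p q z < 0"
    using crit_density_neg[of p q] assms by auto
  obtain t where t: "l = of_real t" "t > 0" using smult_factor_pos[OF eq] .
  define u where "u = (norm (z - c1))^2 * (norm (z - c2))^2"
  have "z^2 * of_real (crit_density p q z) = z^2 * of_real (t * u)"
    using crit_poly_unit_circle[OF z(1), of p q] mirror_poly_unit_circle[OF z(1), of c1 c2]
    unfolding eq t(1) poly_smult u_def[symmetric]
    by (auto simp: mult_ac)
  moreover have "z \<noteq> 0" using z by auto
  ultimately have "of_real (crit_density p q z) = (of_real (t * u) :: complex)" by simp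
  then have "crit_density p q z = t * u" by (simp only: of_real_eq_iff)
  with z t(2) show False by (simp add: u_def mult_less_0_iff)
qed

lemma zeros_exist_unique:
  "\<exists>p q. norm p > 1 \<and> norm q > 1 \<and> (\<forall>p' q'. norm p' > 1 \<longrightarrow> norm q' > 1 \<longrightarrow>
    (proots (crit_poly (p' + q') (p' * q')) = {#c1, c2, 1 / cnj c1, 1 / cnj c2#}
      \<longleftrightarrow> p' + q' = p + q \<and> p' * q' = p * q))"
proof -
  let ?T = "mirror_poly (c1 + c2) (c1 * c2)"
  have nz: "c1 \<noteq> 0" "c2 \<noteq> 0" using c1 c2 by auto
  then have "?T \<noteq> 0" by (simp add: mirror_poly_coeffs)
  have proots_iff: "proots (crit_poly s m) = {#c1, c2, 1 / cnj c1, 1 / cnj c2#}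
      \<longleftrightarrow> (\<exists>l. crit_poly s m = smult l ?T)" if "m \<noteq> 0" for s m
  proof -
    have "crit_poly s m \<noteq> 0" using crit_poly_0[of s m] that by auto
    from proots_eq_iff_smult[OF this \<open>?T \<noteq> 0\<close>] show ?thesis
      unfolding proots_mirror_poly[OF nz] .
  qed
  obtain r where r: "r > 4" "G r = 0" "D r > 0"
    and r_unique: "\<And>r'. r' > 4 \<Longrightarrow> G r' = 0 \<Longrightarrow> D r' > 0 \<Longrightarrow> r' = r"
    using ex1_radius by blast
  obtain p q where pq: "p + q = zsum r" "p * q = zprod r" by (rule vieta_quadratic)
  show ?thesis
  proof (rule exI[of _ p], rule exI[of _ q], intro conjI allI impI)
    show "norm p > 1" "norm q > 1" using outside_iff[OF pq] r by auto
    fix p' q' :: complex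
    assume out: "norm p' > 1" "norm q' > 1"
    then have nz: "p' \<noteq> 0" "q' \<noteq> 0" by auto
    show "proots (crit_poly (p' + q') (p' * q')) = {#c1, c2, 1 / cnj c1, 1 / cnj c2#}
      \<longleftrightarrow> p' + q' = p + q \<and> p' * q' = p * q"
    proof
      assume "proots (crit_poly (p' + q') (p' * q')) = {#c1, c2, 1 / cnj c1, 1 / cnj c2#}"
      then obtain l where l: "crit_poly (p' + q') (p' * q') = smult l ?T"
        using proots_iff[of "p' * q'" "p' + q'"] nz by auto
      have "norm p' > 2" "norm q' > 2"
        using zeros_far_out[OF out l] zeros_far_out[of q' p' l] out l
        by (simp_all add: add.commute mult.commute)
      then have big: "norm (p' * q') > 4"
        using mult_strict_mono[of 2 "norm p'" 2 "norm q'"] nz by (simp add: norm_mult)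
      have eqs: "p' + q' = zsum (norm (p' * q'))" "p' * q' = zprod (norm (p' * q'))"
        "G (norm (p' * q')) = 0"
        using zeros_coeffs_unique[OF l] big by auto
      then have "D (norm (p' * q')) > 0" using outside_iff[OF eqs(1,2)] big out by auto
      with r_unique eqs(3) big have "norm (p' * q') = r" by blast
      with eqs pq show "p' + q' = p + q \<and> p' * q' = p * q" by simp
    next
      assume "p' + q' = p + q \<and> p' * q' = p * q"
      then have eqs: "p' + q' = zsum r" "p' * q' = zprod r" using pq by auto
      then have "zprod r \<noteq> 0" using nz by auto
      then show "proots (crit_poly (p' + q') (p' * q')) = {#c1, c2, 1 / cnj c1, 1 / cnj c2#}"
        unfolding eqs using crit_poly_split[of r] r by (subst proots_iff) auto
    qed
  qed
qed

end

section \<open>Existence and uniqueness\<close>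

lemma poles_poly_1: "poly (poles_poly s m) 1 = cnj (poly (zeros_poly s m) 1)"
  by (simp add: poles_poly_def zeros_poly_def)

text \<open>
  The rotation factor depends on \<open>p\<close> and \<open>q\<close> through their sum and product only, like the rest of
  the map, so the symmetric functions determine the normalized map.
\<close>

lemma blaschke_at_1:
  assumes "norm p > 1" "norm q > 1"
  shows "blaschke \<tau> p q 1 = 1
    \<longleftrightarrow> \<tau> = cnj (poly (zeros_poly (p + q) (p * q)) 1) / poly (zeros_poly (p + q) (p * q)) 1"
proof -
  have "poly (zeros_poly (p + q) (p * q)) 1 \<noteq> 0" using assms by (auto simp: poly_zeros_poly)
  then show ?thesis
    by (auto simp: blaschke_eq_poly_quotient poly_monom poles_poly_1 field_simps)
qed

theorem theorem8p1:
  fixes c1 c2 :: complex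
  assumes "norm c1 > 1" and "norm c2 > 1"
  shows "\<exists>!B. B \<in> B_cal \<and>
    (\<forall>x. crit_mult B x =
       count {#Some 0, Some 0, None, None,
               Some c1, Some c2, Some (1 / cnj c1), Some (1 / cnj c2)#} x)"
proof -
  interpret critical_points c1 c2 using assms by unfold_locales
  let ?crit = "\<lambda>B. \<forall>x. crit_mult B x = count {#Some 0, Some 0, None, None,
               Some c1, Some c2, Some (1 / cnj c1), Some (1 / cnj c2)#} x"
  let ?roots = "{#c1, c2, 1 / cnj c1, 1 / cnj c2#}"
  obtain p q where pq: "norm p > 1" "norm q > 1"
    and roots_iff: "\<And>p' q'. norm p' > 1 \<Longrightarrow> norm q' > 1 \<Longrightarrow>
      proots (crit_poly (p' + q') (p' * q')) = ?roots \<longleftrightarrow> p' + q' = p + q \<and> p' * q' = p * q"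
    using zeros_exist_unique by blast
  define w where "w = poly (zeros_poly (p + q) (p * q)) 1"
  define \<tau> where "\<tau> = cnj w / w"
  have "w \<noteq> 0" using pq by (auto simp: w_def poly_zeros_poly)
  then have \<tau>: "norm \<tau> = 1" by (simp add: \<tau>_def norm_divide)
  show ?thesis
  proof (rule ex1I[of _ "blaschke \<tau> p q"], rule conjI)
    show crit: "?crit (blaschke \<tau> p q)"
      using critical_points_iff_proots[OF \<tau> pq] roots_iff[OF pq] by blast
    have "blaschke \<tau> p q 1 = 1" using blaschke_at_1[OF pq(1,2)] by (simp add: \<tau>_def w_def)
    then have "blaschke \<tau> p q \<in> B_hat" using \<tau> pq unfolding B_hat_def by blast
    moreover have "crit_mult (blaschke \<tau> p q) x
        = count {#Some c1, Some c2, Some (1 / cnj c1), Some (1 / cnj c2)#} x"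
      if "x \<notin> {Some 0, None}" for x
    proof -
      have "Some 0 \<noteq> x" "None \<noteq> x" using that by auto
      then show ?thesis using crit by simp
    qed
    \<comment> \<open>The prescribed points themselves witness membership in \<open>B_cal\<close>.\<close>
    ultimately show "blaschke \<tau> p q \<in> B_cal" using assms unfolding B_cal_def by blast
  next
    fix B assume B: "B \<in> B_cal \<and> ?crit B"
    then obtain \<tau>' p' q' where B_eq: "B = blaschke \<tau>' p' q'"
      and B': "norm \<tau>' = 1" "norm p' > 1" "norm q' > 1" "blaschke \<tau>' p' q' 1 = 1"
      unfolding B_cal_def B_hat_def by blast
    have "proots (crit_poly (p' + q') (p' * q')) = ?roots"
      using critical_points_iff_proots[OF B'(1-3)] B B_eq by blast
    then have same: "p' + q' = p + q" "p' * q' = p * q" using roots_iff[OF B'(2,3)] by blast+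
    then have "\<tau>' = \<tau>" using blaschke_at_1[OF B'(2,3)] B'(4) by (simp add: \<tau>_def w_def)
    with same show "B = blaschke \<tau> p q"
      by (simp add: B_eq fun_eq_iff blaschke_eq_poly_quotient)
  qed
qed

end
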